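(* Let $X$ be a real Hilbert space and let $R\colon X\to X$ be linear and nonexpansive (i.e., $\|Rx-Ry\|\le\|x-y\|$ for all $x,y\in X$). Let $(\mathrm{Id}-R)^{-1}\colon X\rightrightarrows X$ denote the set-valued inverse of $\mathrm{Id}-R$. Then the following hold: (i) $\frac12(\mathrm{Id}-R)$ is firmly nonexpansive. (ii) $\mathrm{Id}-R$ is nonexpansive. (iii) $\mathrm{Id}-R$ and $(\mathrm{Id}-R)^{-1}$ are maximally monotone. (iv) $\mathrm{Id}-R$ is $\frac12$-cocoercive. (v) $(\mathrm{Id}-R)^{-1}$ is strongly monotone with constant $\frac12$. (vi) $\mathrm{Id}-R$ is $3^*$ monotone. (vii) $(\mathrm{Id}-R)^{-1}$ is $3^*$ monotone. (viii) $\mathrm{Id}-R$ is paramonotone. (ix) $(\mathrm{Id}-R)^{-1}-\frac12\mathrm{Id}$ is maximally monotone.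
   Context: $X$ is a real Hilbert space with inner product $\langle\cdot,\cdot\rangle$ and norm $\|\cdot\|$; $\mathrm{Id}$ is the identity on $X$. A set-valued operator $M\colon X\rightrightarrows X$ has graph $\operatorname{gra}M=\{(x,u): u\in Mx\}$, domain $\operatorname{dom}M=\{x: Mx\neq\varnothing\}$, range $\operatorname{ran}M=\bigcup_x Mx$, and inverse $M^{-1}$ with $x\in M^{-1}u\Leftrightarrow u\in Mx$; single-valued maps are regarded as set-valued operators with singleton values. $M-\frac12\mathrm{Id}$ is the operator $x\mapsto\{u-\frac12x: u\in Mx\}$. A map $T\colon X\to X$ is nonexpansive if $\|Tx-Ty\|\le\|x-y\|$ for all $x,y$, and firmly nonexpansive if $\|Tx-Ty\|^2+\|(\mathrm{Id}-T)x-(\mathrm{Id}-T)y\|^2\le\|x-y\|^2$ for all $x,y$. It is $\beta$-cocoercive ($\beta>0$) if $\langle x-y,Tx-Ty\rangle\ge\beta\|Tx-Ty\|^2$ for all $x,y$. $M$ is monotone if $\langle x-y,u-v\rangle\ge0$ for all $(x,u),(y,v)\in\operatorname{gra}M$; maximally monotone if it is monotone and its graph is not properly contained in the graph of another monotone operator; strongly monotone with constant $\beta>0$ if $\langle x-y,u-v\rangle\ge\beta\|x-y\|^2$ for all $(x,u),(y,v)\in\operatorname{gra}M$. A monotone $M$ is paramonotone if $(x,u),(y,v)\in\operatorname{gra}M$ and $\langle x-y,u-v\rangle=0$ imply $(x,v),(y,u)\in\operatorname{gra}M$. A monotone $M$ is $3^*$ monotone if for every $x\in\operatorname{dom}M$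 and every $u\in\operatorname{ran}M$ one has $\inf_{(z,w)\in\operatorname{gra}M}\langle x-z,u-w\rangle>-\infty$.
   Formalization: Item (ii) is false as written (on any nonzero X, R = -Id gives Id - R = 2 Id, which is not nonexpansive); it is proved in the corrected form "(1/2)(Id - R) is nonexpansive", i.e. Id - R is Lipschitz with constant 2. *)

theory Defs
  imports "HOL-Analysis.Analysis"
begin

text \<open>
  A real Hilbert space is a type of sort \<open>{real_inner, complete_space}\<close>.
  A set-valued operator on \<open>X\<close> is a function \<open>'a \<Rightarrow> 'a set\<close>.
\<close>

definition gra :: "('a \<Rightarrow> 'b set) \<Rightarrow> ('a \<times> 'b) set"
  where "gra M = {(x, u). u \<in> M x}"

definition dom_op :: "('a \<Rightarrow> 'b set) \<Rightarrow> 'a set"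
  where "dom_op M = {x. M x \<noteq> {}}"

definition ran_op :: "('a \<Rightarrow> 'b set) \<Rightarrow> 'b set"
  where "ran_op M = (\<Union>x. M x)"

definition inv_op :: "('a \<Rightarrow> 'b set) \<Rightarrow> 'b \<Rightarrow> 'a set"
  where "inv_op M u = {x. u \<in> M x}"

definition op_of :: "('a \<Rightarrow> 'b) \<Rightarrow> 'a \<Rightarrow> 'b set"
  where "op_of T x = {T x}"

definition minus_op :: "('a \<Rightarrow> 'b::minus set) \<Rightarrow> ('a \<Rightarrow> 'b) \<Rightarrow> 'a \<Rightarrow> 'b set"
  where "minus_op M T x = {u - T x | u. u \<in> M x}"

definition nonexpansive :: "('a::real_normed_vector \<Rightarrow> 'a) \<Rightarrow> bool"
  where "nonexpansive T \<longleftrightarrow> (\<forall>x y. norm (T x - T y) \<le> norm (x - y))"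

definition firmly_nonexpansive :: "('a::real_normed_vector \<Rightarrow> 'a) \<Rightarrow> bool"
  where "firmly_nonexpansive T \<longleftrightarrow>
    (\<forall>x y. (norm (T x - T y))\<^sup>2 + (norm ((x - T x) - (y - T y)))\<^sup>2 \<le> (norm (x - y))\<^sup>2)"

definition cocoercive :: "real \<Rightarrow> ('a::real_inner \<Rightarrow> 'a) \<Rightarrow> bool"
  where "cocoercive \<beta> T \<longleftrightarrow>
    0 < \<beta> \<and> (\<forall>x y. inner (x - y) (T x - T y) \<ge> \<beta> * (norm (T x - T y))\<^sup>2)"

definition monotone_op :: "('a::real_inner \<Rightarrow> 'a set) \<Rightarrow> bool"
  where "monotone_op M \<longleftrightarrow>
    (\<forall>(x, u)\<in>gra M. \<forall>(y, v)\<in>gra M. inner (x - y) (u - v) \<ge> 0)"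

definition maximally_monotone :: "('a::real_inner \<Rightarrow> 'a set) \<Rightarrow> bool"
  where "maximally_monotone M \<longleftrightarrow>
    monotone_op M \<and> \<not> (\<exists>N. monotone_op N \<and> gra M \<subset> gra N)"

definition strongly_monotone :: "real \<Rightarrow> ('a::real_inner \<Rightarrow> 'a set) \<Rightarrow> bool"
  where "strongly_monotone \<beta> M \<longleftrightarrow>
    0 < \<beta> \<and>
    (\<forall>(x, u)\<in>gra M. \<forall>(y, v)\<in>gra M. inner (x - y) (u - v) \<ge> \<beta> * (norm (x - y))\<^sup>2)"

definition paramonotone :: "('a::real_inner \<Rightarrow> 'a set) \<Rightarrow> bool"
  where "paramonotone M \<longleftrightarrow>
    monotone_op M \<and>
    (\<forall>(x, u)\<in>gra M. \<forall>(y, v)\<in>gra M.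
       inner (x - y) (u - v) = 0 \<longrightarrow> (x, v) \<in> gra M \<and> (y, u) \<in> gra M)"

text \<open>The infimum is taken in the extended reals, since in \<open>real\<close> the infimum of a set that is
  unbounded below carries no information.\<close>

definition three_star_monotone :: "('a::real_inner \<Rightarrow> 'a set) \<Rightarrow> bool"
  where "three_star_monotone M \<longleftrightarrow>
    monotone_op M \<and>
    (\<forall>x\<in>dom_op M. \<forall>u\<in>ran_op M.
       (INF (z, w)\<in>gra M. ereal (inner (x - z) (u - w))) > -\<infinity>)"

text \<open>
  For linear nonexpansive \<open>R\<close> the map \<open>Id - R\<close> itself need not be nonexpansive: on every nonzero
  space \<open>R = -Id\<close> gives \<open>Id - R = 2 Id\<close>. What holds is that \<open>(1/2) (Id - R)\<close> is nonexpansive,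
  equivalently that \<open>Id - R\<close> is Lipschitz with constant 2.
\<close>

lemma id_minus_nonexpansive_counterexample:
  fixes a :: "'a::real_normed_vector"
  assumes "a \<noteq> 0"
  shows "linear (uminus :: 'a \<Rightarrow> 'a)"
    and "nonexpansive (uminus :: 'a \<Rightarrow> 'a)"
    and "\<not> nonexpansive (\<lambda>x :: 'a. x - (- x))"
proof -
  show "linear (uminus :: 'a \<Rightarrow> 'a)"
    by (rule linearI) simp_all
  show "nonexpansive (uminus :: 'a \<Rightarrow> 'a)"
    by (simp add: nonexpansive_def norm_minus_commute)
  have "norm ((a - (- a)) - (0 - (- 0))) = 2 * norm (a - 0)"
    using norm_scaleR[of 2 a] by (simp add: scaleR_2)
  then have "\<not> norm ((a - (- a)) - (0 - (- 0))) \<le> norm (a - 0)"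
    using assms by simp
  then show "\<not> nonexpansive (\<lambda>x :: 'a. x - (- x))"
    unfolding nonexpansive_def by blast
qed

end

theory Submission
  imports Defs
begin

text \<open>
  Put \<open>d = x - y\<close> and \<open>e = R x - R y\<close>. The identity
  \<open>\<langle>d, d - e\<rangle> - \<parallel>d - e\<parallel>\<^sup>2 / 2 = (\<parallel>d\<parallel>\<^sup>2 - \<parallel>e\<parallel>\<^sup>2) / 2\<close> shows that \<open>Id - R\<close> is
  \<open>1/2\<close>-cocoercive, and every item but (i), (ii) and (ix) holds for cocoercive maps in general.
  For (ix), the change of variables \<open>p = v + y / 2\<close>, \<open>q = v - y / 2\<close> turns the pairing
  \<open>\<langle>y - y', v - v'\<rangle>\<close> into \<open>(\<parallel>p - p'\<parallel>\<^sup>2 - \<parallel>q - q'\<parallel>\<^sup>2) / 2\<close> and the graph of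
  \<open>(Id - R)\<^sup>-\<^sup>1 - Id / 2\<close> into that of \<open>R\<close>. A point \<open>(p, q)\<close> with
  \<open>\<parallel>q - R p'\<parallel> \<le> \<parallel>p - p'\<parallel>\<close> for all \<open>p'\<close> has \<open>q = R p\<close>, as the choice \<open>p' = p\<close> shows.
\<close>

section \<open>Graphs, inverses and maximality\<close>

lemma gra_op_of: "gra (op_of T) = range (\<lambda>x. (x, T x))"
  by (auto simp: gra_def op_of_def)

lemma gra_inv_op: "gra (inv_op M) = prod.swap ` gra M"
  by (auto simp: gra_def inv_op_def image_iff)

lemma monotone_op_inv_op:
  assumes "monotone_op M"
  shows "monotone_op (inv_op M)"
  using assms by (fastforce simp: monotone_op_def gra_inv_op inner_commute)

text \<open>Swapping coordinates is an involution on graphs that keeps strict inclusion, so a proper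
  monotone extension of the inverse would invert to one of \<open>M\<close>.\<close>

lemma maximally_monotone_inv_op:
  assumes "maximally_monotone M"
  shows "maximally_monotone (inv_op M)"
  unfolding maximally_monotone_def
proof (intro conjI notI)
  show "monotone_op (inv_op M)"
    using assms by (simp add: maximally_monotone_def monotone_op_inv_op)
next
  assume "\<exists>N. monotone_op N \<and> gra (inv_op M) \<subset> gra N"
  then obtain N where N: "monotone_op N" "gra (inv_op M) \<subset> gra N"
    by blast
  have "gra M \<subset> gra (inv_op N)"
    using N(2) image_strict_mono[of prod.swap "gra N" "gra (inv_op M)"]
    by (simp add: gra_inv_op image_image)
  then show False
    using assms monotone_op_inv_op[OF N(1)] by (auto simp: maximally_monotone_def)
qed

text \<open>Every point of a monotone extension is monotonically related to all of
  \<open>gra M\<close>, so it is enough to place such points in \<open>gra M\<close>.\<close>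

lemma maximally_monotoneI:
  assumes "monotone_op M"
    and "\<And>x u. (\<And>y v. (y, v) \<in> gra M \<Longrightarrow> inner (x - y) (u - v) \<ge> 0) \<Longrightarrow> (x, u) \<in> gra M"
  shows "maximally_monotone M"
  unfolding maximally_monotone_def
proof (intro conjI notI)
  assume "\<exists>N. monotone_op N \<and> gra M \<subset> gra N"
  then obtain N x u where N: "monotone_op N" "gra M \<subset> gra N" "(x, u) \<in> gra N" "(x, u) \<notin> gra M"
    by auto
  have "inner (x - y) (u - v) \<ge> 0" if "(y, v) \<in> gra M" for y v
    using N(1-3) that unfolding monotone_op_def by blast
  then show False
    using assms(2) N(4) by blast
qed (rule assms(1))

text \<open>Inversion exchanges domain and range, and the infimum runs over the same values because
  the inner product is symmetric.\<close>

lemma three_star_monotone_inv_op: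
  assumes "three_star_monotone M"
  shows "three_star_monotone (inv_op M)"
proof -
  have dom: "dom_op (inv_op M) = ran_op M" and ran: "ran_op (inv_op M) = dom_op M"
    by (auto simp: dom_op_def ran_op_def inv_op_def)
  have "(INF (z, w)\<in>gra (inv_op M). ereal (inner (u - z) (x - w)))
      = (INF (z, w)\<in>gra M. ereal (inner (x - z) (u - w)))" for x u
    by (simp add: gra_inv_op image_image case_prod_unfold inner_commute)
  then show ?thesis
    using assms by (simp add: three_star_monotone_def monotone_op_inv_op dom ran)
qed

section \<open>Cocoercive maps\<close>

lemma cocoercive_norm_le:
  assumes "cocoercive \<beta> T"
  shows "\<beta> * norm (T x - T y) \<le> norm (x - y)"
proof (cases "T x = T y")
  case False
  have "\<beta> * (norm (T x - T y))\<^sup>2 \<le> norm (x - y) * norm (T x - T y)"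
    using assms norm_cauchy_schwarz[of "x - y" "T x - T y"] order_trans
    unfolding cocoercive_def by blast
  then show ?thesis
    using False by (simp add: power2_eq_square)
qed simp

lemma cocoercive_inner_nonneg:
  assumes "cocoercive \<beta> T"
  shows "inner (x - y) (T x - T y) \<ge> 0"
proof -
  have "0 \<le> \<beta> * (norm (T x - T y))\<^sup>2"
    using assms by (simp add: cocoercive_def)
  also have "\<dots> \<le> inner (x - y) (T x - T y)"
    using assms by (simp add: cocoercive_def)
  finally show ?thesis .
qed

lemma cocoercive_imp_monotone_op:
  assumes "cocoercive \<beta> T"
  shows "monotone_op (op_of T)"
  using cocoercive_inner_nonneg[OF assms] by (auto simp: monotone_op_def gra_op_of)

lemma cocoercive_imp_maximally_monotone:
  assumes "cocoercive \<beta> T"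
  shows "maximally_monotone (op_of T)"
proof (rule maximally_monotoneI[OF cocoercive_imp_monotone_op[OF assms]])
  fix x u
  assume related: "\<And>y v. (y, v) \<in> gra (op_of T) \<Longrightarrow> inner (x - y) (u - v) \<ge> 0"
  have \<beta>: "\<beta> > 0"
    using assms by (simp add: cocoercive_def)
  define h where "h = u - T x"
  \<comment> \<open>Relatedness at \<open>z\<close> bounds the square of \<open>norm h\<close> by
    \<open>inner h (T z - T x)\<close>. The step length \<beta>/2 is small enough for the Lipschitz
    constant 1/\<beta> to give \<open>norm (T z - T x) \<le> norm h / 2\<close>, which forces
    \<open>h = 0\<close>.\<close>
  define z where "z = x + (\<beta>/2) *\<^sub>R h"
  have "inner (x - z) (u - T z) \<ge> 0"
    by (rule related) (simp add: gra_op_of)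
  then have "inner h (h - (T z - T x)) \<le> 0"
    using \<beta> by (simp add: z_def h_def mult_le_0_iff)
  then have "(norm h)\<^sup>2 \<le> inner h (T z - T x)"
    by (simp add: inner_diff_right power2_norm_eq_inner)
  also have "\<dots> \<le> norm h * norm (T z - T x)"
    by (rule norm_cauchy_schwarz)
  also have "\<dots> \<le> norm h * (norm h / 2)"
  proof (rule mult_left_mono)
    have "\<beta> * norm (T z - T x) \<le> \<beta> * (norm h / 2)"
      using cocoercive_norm_le[OF assms, of z x] \<beta> by (simp add: z_def)
    then show "norm (T z - T x) \<le> norm h / 2"
      using \<beta> mult_le_cancel_left_pos by blast
  qed simp
  finally have "(norm h)\<^sup>2 \<le> 0"
    by (simp add: power2_eq_square)
  then show "(x, u) \<in> gra (op_of T)"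
    by (simp add: h_def gra_op_of)
qed

lemma cocoercive_imp_strongly_monotone_inv_op:
  assumes "cocoercive \<beta> T"
  shows "strongly_monotone \<beta> (inv_op (op_of T))"
  using assms
  by (auto simp: strongly_monotone_def cocoercive_def gra_inv_op gra_op_of inner_commute)

text \<open>With \<open>u = T y\<close>, split \<open>x - z\<close> into the fixed
  \<open>x - y\<close> and \<open>y - z\<close>. The quadratic gain from cocoercivity outweighs the
  linear Cauchy-Schwarz loss.\<close>

lemma cocoercive_imp_three_star_monotone:
  assumes "cocoercive \<beta> T"
  shows "three_star_monotone (op_of T)"
  unfolding three_star_monotone_def
proof (intro conjI ballI)
  fix x u
  assume "u \<in> ran_op (op_of T)"
  then obtain y where u: "u = T y"
    by (auto simp: ran_op_def op_of_def)
  have \<beta>: "\<beta> > 0"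
    using assms by (simp add: cocoercive_def)
  define c where "c = norm (x - y)"
  have bound: "- (c\<^sup>2 / (4 * \<beta>)) \<le> inner (x - z) (u - T z)" for z
  proof -
    define d where "d = norm (T y - T z)"
    \<comment> \<open>Completing the square gives a lower bound independent of \<open>d\<close>,
      hence of \<open>z\<close>.\<close>
    have "0 \<le> (2 * \<beta> * d - c)\<^sup>2 / (4 * \<beta>)"
      using \<beta> by simp
    also have "\<dots> = \<beta> * d\<^sup>2 - c * d + c\<^sup>2 / (4 * \<beta>)"
      using \<beta> by (simp add: field_simps power2_eq_square)
    finally have "- (c\<^sup>2 / (4 * \<beta>)) \<le> - (c * d) + \<beta> * d\<^sup>2"
      by simp
    also have "\<dots> \<le> inner (x - y) (T y - T z) + inner (y - z) (T y - T z)"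
    proof (rule add_mono)
      show "- (c * d) \<le> inner (x - y) (T y - T z)"
        using Cauchy_Schwarz_ineq2[of "x - y" "T y - T z"] by (simp add: c_def d_def)
      show "\<beta> * d\<^sup>2 \<le> inner (y - z) (T y - T z)"
        using assms by (simp add: cocoercive_def d_def)
    qed
    also have "\<dots> = inner (x - z) (u - T z)"
      by (simp add: u flip: inner_add_left)
    finally show ?thesis .
  qed
  have "- \<infinity> < ereal (- (c\<^sup>2 / (4 * \<beta>)))"
    by simp
  also have "\<dots> \<le> (INF (z, w)\<in>gra (op_of T). ereal (inner (x - z) (u - w)))"
    using bound by (intro INF_greatest) (auto simp: gra_op_of)
  finally show "- \<infinity> < (INF (z, w)\<in>gra (op_of T). ereal (inner (x - z) (u - w)))" .
qed (rule cocoercive_imp_monotone_op[OF assms])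

text \<open>A zero pairing forces \<open>T x = T y\<close> by cocoercivity, and exchanging equal
  values stays in the graph.\<close>

lemma cocoercive_imp_paramonotone:
  assumes "cocoercive \<beta> T"
  shows "paramonotone (op_of T)"
proof -
  have "T x = T y" if "inner (x - y) (T x - T y) = 0" for x y
  proof -
    have "\<beta> > 0" "\<beta> * (norm (T x - T y))\<^sup>2 \<le> 0"
      using assms that by (auto simp: cocoercive_def dest: spec2[of _ x y])
    then show ?thesis
      by (simp add: mult_le_0_iff)
  qed
  then show ?thesis
    using cocoercive_imp_monotone_op[OF assms]
    by (fastforce simp: paramonotone_def gra_op_of)
qed

lemma firmly_nonexpansive_imp_nonexpansive:
  assumes "firmly_nonexpansive T"
  shows "nonexpansive T"
  unfolding nonexpansive_def
proof (intro allI)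
  fix x y
  have "(norm (T x - T y))\<^sup>2 + (norm ((x - T x) - (y - T y)))\<^sup>2 \<le> (norm (x - y))\<^sup>2"
    using assms by (simp add: firmly_nonexpansive_def)
  then have "(norm (T x - T y))\<^sup>2 \<le> (norm (x - y))\<^sup>2"
    using zero_le_power2[of "norm ((x - T x) - (y - T y))"] by linarith
  then show "norm (T x - T y) \<le> norm (x - y)"
    by (simp add: power2_le_iff_abs_le)
qed

section \<open>Nonexpansive maps\<close>

context
  fixes R :: "'a::real_inner \<Rightarrow> 'a"
  assumes R: "nonexpansive R"
begin

lemma nonexpansive_power2: "(norm (R x - R y))\<^sup>2 \<le> (norm (x - y))\<^sup>2"
  using R by (intro power_mono) (auto simp: nonexpansive_def)

text \<open>The map and its complement have differences \<open>(d - e) / 2\<close> and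
  \<open>(d + e) / 2\<close>, so the parallelogram law turns the sum of squares into a mean of the
  squared norms of \<open>d\<close> and \<open>e\<close>.\<close>

lemma nonexpansive_imp_firmly_nonexpansive_half:
  "firmly_nonexpansive (\<lambda>x. (1/2) *\<^sub>R (x - R x))"
  unfolding firmly_nonexpansive_def
proof (intro allI)
  fix x y
  define d e where "d = x - y" and "e = R x - R y"
  have 1: "(1/2) *\<^sub>R (x - R x) - (1/2) *\<^sub>R (y - R y) = (1/2) *\<^sub>R (d - e)"
    by (simp add: d_def e_def algebra_simps)
  have "x = (1/2) *\<^sub>R x + (1/2) *\<^sub>R x" "y = (1/2) *\<^sub>R y + (1/2) *\<^sub>R y"
    by (simp_all flip: scaleR_left_distrib)
  then have 2: "(x - (1/2) *\<^sub>R (x - R x)) - (y - (1/2) *\<^sub>R (y - R y)) = (1/2) *\<^sub>R (d + e)"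
    unfolding d_def e_def scaleR_diff_right scaleR_add_right by (simp add: algebra_simps)
  have "(norm ((1/2) *\<^sub>R (d - e)))\<^sup>2 + (norm ((1/2) *\<^sub>R (d + e)))\<^sup>2 = ((norm d)\<^sup>2 + (norm e)\<^sup>2) / 2"
    by (simp add: power2_norm_eq_inner inner_diff inner_add inner_commute field_simps)
  also have "\<dots> \<le> (norm d)\<^sup>2"
    using nonexpansive_power2[of x y] by (simp add: d_def e_def)
  finally show "(norm ((1/2) *\<^sub>R (x - R x) - (1/2) *\<^sub>R (y - R y)))\<^sup>2
      + (norm ((x - (1/2) *\<^sub>R (x - R x)) - (y - (1/2) *\<^sub>R (y - R y))))\<^sup>2 \<le> (norm (x - y))\<^sup>2"
    unfolding 1 2 by (simp add: d_def)
qed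

lemma nonexpansive_imp_cocoercive_half: "cocoercive (1/2) (\<lambda>x. x - R x)"
  unfolding cocoercive_def
proof (intro conjI allI)
  fix x y
  define d e where "d = x - y" and "e = R x - R y"
  have "inner d (d - e) - (norm (d - e))\<^sup>2 / 2 = ((norm d)\<^sup>2 - (norm e)\<^sup>2) / 2"
    by (simp add: power2_norm_eq_inner inner_diff inner_commute field_simps)
  also have "\<dots> \<ge> 0"
    using nonexpansive_power2[of x y] by (simp add: d_def e_def)
  finally have "1/2 * (norm (d - e))\<^sup>2 \<le> inner d (d - e)"
    by simp
  moreover have "(x - R x) - (y - R y) = d - e"
    by (simp add: d_def e_def)
  ultimately show "1/2 * (norm ((x - R x) - (y - R y)))\<^sup>2 \<le> inner (x - y) ((x - R x) - (y - R y))"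
    by (simp only: d_def[symmetric])
qed simp

lemma nonexpansive_imp_maximally_monotone_inv_minus_half:
  "maximally_monotone (minus_op (inv_op (op_of (\<lambda>x. x - R x))) (\<lambda>x. (1/2) *\<^sub>R x))"
    (is "maximally_monotone ?M")
proof (rule maximally_monotoneI)
  have gra: "gra ?M = range (\<lambda>x. (x - R x, x - (1/2) *\<^sub>R (x - R x)))"
    by (auto simp: gra_def minus_op_def inv_op_def op_of_def)
  have pairing: "inner (y - (x - R x)) (v - (x - (1/2) *\<^sub>R (x - R x)))
      = ((norm (v + (1/2) *\<^sub>R y - x))\<^sup>2 - (norm (v - (1/2) *\<^sub>R y - R x))\<^sup>2) / 2" for x y v
    by (simp add: power2_norm_eq_inner inner_diff inner_add inner_commute field_simps)
  \<comment> \<open>At the graph point with parameter \<open>z\<close>, this is the difference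
    \<open>v - y / 2\<close>, so \<open>pairing\<close> compares \<open>R z - R x\<close> with
    \<open>z - x\<close>.\<close>
  have "z - (1/2) *\<^sub>R (z - R z) - (1/2) *\<^sub>R (z - R z) = R z" for z
    by (simp add: diff_diff_eq flip: scaleR_left_distrib)
  then show "monotone_op ?M"
    using nonexpansive_power2 by (auto simp: monotone_op_def gra pairing)
  show "(y, v) \<in> gra ?M" if "\<And>y' v'. (y', v') \<in> gra ?M \<Longrightarrow> inner (y - y') (v - v') \<ge> 0" for y v
  proof -
    \<comment> \<open>At \<open>x = p\<close> the first square in \<open>pairing\<close> vanishes,
      so nonnegativity makes the second vanish too.\<close>
    define p where "p = v + (1/2) *\<^sub>R y"
    have "inner (y - (p - R p)) (v - (p - (1/2) *\<^sub>R (p - R p))) \<ge> 0"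
      by (rule that) (simp add: gra)
    then have "R p = v - (1/2) *\<^sub>R y"
      unfolding pairing by (simp add: p_def)
    then have "p - R p = (1/2) *\<^sub>R y + (1/2) *\<^sub>R y"
      by (simp add: p_def)
    then have "p - R p = y"
      by (simp flip: scaleR_left_distrib)
    then have "(y, v) = (p - R p, p - (1/2) *\<^sub>R (p - R p))"
      by (simp add: p_def)
    then show ?thesis
      unfolding gra by blast
  qed
qed

end

theorem proposition2p1:
  fixes R :: "'a::{real_inner, complete_space} \<Rightarrow> 'a"
  assumes "linear R" and "nonexpansive R"
  shows "firmly_nonexpansive (\<lambda>x. (1/2) *\<^sub>R (x - R x))
    \<and> nonexpansive (\<lambda>x. (1/2) *\<^sub>R (x - R x))
    \<and> (maximally_monotone (op_of (\<lambda>x. x - R x))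
       \<and> maximally_monotone (inv_op (op_of (\<lambda>x. x - R x))))
    \<and> cocoercive (1/2) (\<lambda>x. x - R x)
    \<and> strongly_monotone (1/2) (inv_op (op_of (\<lambda>x. x - R x)))
    \<and> three_star_monotone (op_of (\<lambda>x. x - R x))
    \<and> three_star_monotone (inv_op (op_of (\<lambda>x. x - R x)))
    \<and> paramonotone (op_of (\<lambda>x. x - R x))
    \<and> maximally_monotone (minus_op (inv_op (op_of (\<lambda>x. x - R x))) (\<lambda>x. (1/2) *\<^sub>R x))"
proof -
  note cocoercive = nonexpansive_imp_cocoercive_half[OF assms(2)]
  note maximal = cocoercive_imp_maximally_monotone[OF cocoercive]
  note three_star = cocoercive_imp_three_star_monotone[OF cocoercive]
  note firmly = nonexpansive_imp_firmly_nonexpansive_half[OF assms(2)]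
  show ?thesis
    by (intro conjI firmly firmly_nonexpansive_imp_nonexpansive[OF firmly]
        maximal maximally_monotone_inv_op[OF maximal] cocoercive
        cocoercive_imp_strongly_monotone_inv_op[OF cocoercive]
        three_star three_star_monotone_inv_op[OF three_star]
        cocoercive_imp_paramonotone[OF cocoercive]
        nonexpansive_imp_maximally_monotone_inv_minus_half[OF assms(2)])
qed

end
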